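(* Let $(\Phi,H,\Phi^* )$ be a Gelfand triple with injections $\mathfrak{i}:\Phi\to H$ and $\mathfrak{j}:H\to\Phi^*$, and let $T:H\to H$ be a linear operator with dense domain $D(T)$ such that $\mathfrak{i}(\Phi)\subset D(T^* )$, $T^*(\mathfrak{i}(\Phi))\subset\mathfrak{i}(\Phi)$, and $T^*|_\Phi:=\mathfrak{i}^{-1}T^*\mathfrak{i}:\Phi\to\Phi$ is continuous. Let $T^\times:\Phi^*\to\Phi^*$ be the unique continuous linear map with $\langle g,T^\times\mu\rangle=\langle T^*|_\Phi\,g,\mu\rangle$ for all $g\in\Phi$, $\mu\in\Phi^*$. Then for every $h\in D(T)$, $$\mathfrak{j}(Th)=T^\times\,\mathfrak{j}(h).$$
   Context: Gelfand triple: $H$ is a complex Hilbert space (inner product linear in the first variable); $\Phi$ and $\Phi^*$ are locally convex Hausdorff topological vector spaces over $\mathbb{C}$ with a separately continuous pairing $\langle\cdot,\cdot\rangle:\Phi\times\Phi^*\to\mathbb{C}$, linear in the first variable and conjugate-linear in the second; $\mathfrak{i}:\Phi\to H$ and $\mathfrak{j}:H\to\Phi^*$ are injective continuous linear maps, such that (1) $\mathfrak{i}(\Phi)$ is dense in $H$; (2) the anti-linear map $\mathfrak{s}:\Phi^*\to\Phi'$, $\mu\mapsto\langle\cdot,\mu\rangle$, is a bijective homeomorphism onto the dual space $\Phi'$ with the strong topology; (3) $\langle g,\mathfrak{j}(h)\rangle=\langle\mathfrak{i}(g),h\rangle_H$ for $g\in\Phi$, $h\in H$. Equivalently, $T^\times=\mathfrak{s}^{-1}(T^*|_\Phi)'\mathfrak{s}$,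 where $(\cdot)'$ is the dual map. *)

theory Defs
  imports "HOL-Analysis.Analysis"
begin

section \<open>Complex vector spaces, locally convex spaces and Hilbert spaces\<close>

class scaleC =
  fixes scaleC :: "complex \<Rightarrow> 'a \<Rightarrow> 'a"  (infixr \<open>*\<^sub>C\<close> 75)

text \<open>The real vector space structure is the restriction of the complex one; it is kept as a
  superclass so that the library notions for real vector spaces (\<^const>\<open>convex\<close>, \<^const>\<open>norm\<close>)
  apply.\<close>

class complex_vector = real_vector + scaleC +
  assumes scaleC_add_right: "c *\<^sub>C (x + y) = c *\<^sub>C x + c *\<^sub>C y"
    and scaleC_add_left: "(c + d) *\<^sub>C x = c *\<^sub>C x + d *\<^sub>C x"
    and scaleC_scaleC: "c *\<^sub>C d *\<^sub>C x = (c * d) *\<^sub>C x"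
    and scaleC_one: "1 *\<^sub>C x = x"
    and scaleR_scaleC: "r *\<^sub>R x = complex_of_real r *\<^sub>C x"

global_interpretation complex_vector:
  vector_space "scaleC :: complex \<Rightarrow> 'a::complex_vector \<Rightarrow> 'a"
  by unfold_locales (simp_all add: scaleC_add_right scaleC_add_left scaleC_scaleC scaleC_one)

class complex_lcs = complex_vector + topological_ab_group_add + t2_space +
  assumes tendsto_scaleC_Pair:
      "LIM p (nhds c \<times>\<^sub>F nhds x). fst p *\<^sub>C snd p :> nhds (c *\<^sub>C x)"
    and locally_convex_expanded: "\<lbrakk>open U; 0 \<in> U\<rbrakk> \<Longrightarrow> \<exists>V. open V \<and> 0 \<in> V \<and> V \<subseteq> U \<and>
      (\<forall>x\<in>V. \<forall>y\<in>V. \<forall>u\<ge>0. \<forall>v\<ge>0. u + v = 1 \<longrightarrow> u *\<^sub>R x + v *\<^sub>R y \<in> V)"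

text \<open>The last line of the class axiom is the definition of \<^const>\<open>convex\<close>, written out because
  constants with a sort constraint cannot be used in a class specification.\<close>

lemma locally_convex:
  fixes U :: "'a::complex_lcs set"
  assumes "open U" "0 \<in> U"
  shows "\<exists>V. open V \<and> convex V \<and> 0 \<in> V \<and> V \<subseteq> U"
  using locally_convex_expanded[OF assms] unfolding convex_def by blast

text \<open>The inner product is linear in the first variable. Since norms are real and nonnegative and
  vanish only at zero, the last axiom includes positive definiteness.\<close>

class complex_hilbert_space = complex_vector + banach +
  fixes cinner :: "'a \<Rightarrow> 'a \<Rightarrow> complex"
  assumes cinner_add_left: "cinner (x + y) z = cinner x z + cinner y z"
    and cinner_scaleC_left: "cinner (c *\<^sub>C x) y = c * cinner x y"
    and cinner_commute: "cinner y x = cnj (cinner x y)"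
    and cinner_self: "cinner x x = complex_of_real ((norm x)\<^sup>2)"

lemma cinner_add_right: "cinner (x::'a::complex_hilbert_space) (y+z) = cinner x y + cinner x z"
  by (metis cinner_add_left cinner_commute complex_cnj_add)

lemma cinner_scaleC_right: "cinner (x::'a::complex_hilbert_space) (c *\<^sub>C y) = cnj c * cinner x y"
  by (metis cinner_scaleC_left cinner_commute complex_cnj_mult)

lemma cinner_dense_eq:
  fixes z w :: "'a::complex_hilbert_space"
  assumes D: "closure D = UNIV" and e: "\<And>x. x \<in> D \<Longrightarrow> cinner x z = cinner x w"
  shows "z = w"
proof (rule ccontr)
  define v where "v = z - w"
  assume "z \<noteq> w" then have v: "v \<noteq> 0" by (simp add: v_def)
  have vv: "cinner x z = cinner x v + cinner x w" for x
    using cinner_add_right[of x v w] by (simp add: v_def)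
  have ev: "cinner x v = 0" if "x \<in> D" for x using e[OF that] vv[of x] by simp
  obtain x where x: "x \<in> D" "dist x v < norm v"
    using D v closure_approachable[of v D] by (metis UNIV_I zero_less_norm_iff)
  define u where "u = v - x"
  have xv: "cinner x v = 0" "cinner v x = 0" using ev[OF x(1)] cinner_commute[of v x] by simp_all
  have x1: "v = u + x" by (simp add: u_def)
  have uv: "cinner v v = cinner u v" using xv cinner_add_left[of u x v] x1 by simp
  have ux: "cinner v x = cinner u x + cinner x x" using cinner_add_left[of u x x] x1 by simp
  have uu: "cinner u v = cinner u u + cinner u x" using cinner_add_right[of u u x] x1 by simp
  have "cinner v v + cinner x x = cinner u u"
    unfolding uv uu using ux xv(2) by (metis add.assoc add.right_neutral)
  then have "complex_of_real ((norm v)\<^sup>2 + (norm x)\<^sup>2) = complex_of_real ((norm u)\<^sup>2)"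
    by (simp only: cinner_self of_real_add)
  then have e2: "(norm v)\<^sup>2 + (norm x)\<^sup>2 = (norm u)\<^sup>2" by (rule of_real_eq_iff[THEN iffD1])
  have "norm v \<le> norm u" by (rule power2_le_imp_le) (simp_all add: e2[symmetric])
  then show False using x(2) by (simp add: u_def dist_norm norm_minus_commute)
qed


section \<open>The strong dual\<close>

definition continuous_dual :: "('f::complex_lcs \<Rightarrow> complex) set"
  where "continuous_dual = {f. Vector_Spaces.linear scaleC (*) f \<and> continuous_on UNIV f}"

definition bounded_lcs :: "'f::complex_lcs set \<Rightarrow> bool"
  where "bounded_lcs B \<longleftrightarrow>
    (\<forall>U. open U \<and> 0 \<in> U \<longrightarrow> (\<exists>r>0. \<forall>c. r \<le> cmod c \<longrightarrow> B \<subseteq> scaleC c ` U))"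

text \<open>The topology of uniform convergence on the bounded subsets.\<close>

definition strong_dual_topology :: "('f::complex_lcs \<Rightarrow> complex) topology"
  where "strong_dual_topology = topology (\<lambda>U. U \<subseteq> continuous_dual \<and>
    (\<forall>f\<in>U. \<exists>B e. bounded_lcs B \<and> 0 < e \<and>
       {k \<in> continuous_dual. \<forall>x\<in>B. cmod (k x - f x) < e} \<subseteq> U))"

lemma bounded_lcs_Un:
  assumes "bounded_lcs A" "bounded_lcs B"
  shows "bounded_lcs (A \<union> B)"
  unfolding bounded_lcs_def
proof (intro allI impI)
  fix U :: "'a set" assume U: "open U \<and> 0 \<in> U"
  obtain r where r: "r > 0" "\<And>c. r \<le> cmod c \<Longrightarrow> A \<subseteq> scaleC c ` U"
    using assms(1) U unfolding bounded_lcs_def by blast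
  obtain s where s: "s > 0" "\<And>c. s \<le> cmod c \<Longrightarrow> B \<subseteq> scaleC c ` U"
    using assms(2) U unfolding bounded_lcs_def by blast
  show "\<exists>r>0. \<forall>c. r \<le> cmod c \<longrightarrow> A \<union> B \<subseteq> scaleC c ` U"
    using r s by (intro exI[of _ "max r s"]) auto
qed

lemma bounded_lcs_empty: "bounded_lcs {}"
  unfolding bounded_lcs_def by (auto intro: exI[of _ 1])

lemma openin_strong_dual_topology:
  fixes U :: "('a::complex_lcs \<Rightarrow> complex) set"
  shows "openin strong_dual_topology U \<longleftrightarrow> U \<subseteq> continuous_dual \<and>
    (\<forall>f\<in>U. \<exists>B e. bounded_lcs B \<and> 0 < e \<and>
       {k \<in> continuous_dual. \<forall>x\<in>B. cmod (k x - f x) < e} \<subseteq> U)"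
proof -
  let ?N = "\<lambda>(f :: 'a \<Rightarrow> complex) B e. {k \<in> continuous_dual. \<forall>x\<in>B. cmod (k x - f x) < e}"
  let ?L = "\<lambda>U :: ('a \<Rightarrow> complex) set. U \<subseteq> continuous_dual \<and>
    (\<forall>f\<in>U. \<exists>B e. bounded_lcs B \<and> 0 < e \<and> ?N f B e \<subseteq> U)"
  have "istopology ?L"
    unfolding istopology_def
  proof (intro conjI allI impI)
    fix S T :: "('a \<Rightarrow> complex) set" assume S: "?L S" and T: "?L T"
    show "S \<inter> T \<subseteq> continuous_dual" using S by blast
    show "\<forall>f\<in>S \<inter> T. \<exists>B e. bounded_lcs B \<and> 0 < e \<and> ?N f B e \<subseteq> S \<inter> T"
    proof
      fix f assume f: "f \<in> S \<inter> T"
      obtain A d where A: "bounded_lcs A" "0 < d" "?N f A d \<subseteq> S"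
        using S f by blast
      obtain B e where B: "bounded_lcs B" "0 < e" "?N f B e \<subseteq> T"
        using T f by blast
      have "?N f (A \<union> B) (min d e) \<subseteq> S \<inter> T"
        using A(3) B(3) by auto
      moreover have "bounded_lcs (A \<union> B)" "0 < min d e"
        using A B by (simp_all add: bounded_lcs_Un)
      ultimately show "\<exists>B e. bounded_lcs B \<and> 0 < e \<and> ?N f B e \<subseteq> S \<inter> T"
        by blast
    qed
  next
    fix K :: "('a \<Rightarrow> complex) set set" assume K: "\<forall>S\<in>K. ?L S"
    then show "\<Union>K \<subseteq> continuous_dual" by blast
    show "\<forall>f\<in>\<Union>K. \<exists>B e. bounded_lcs B \<and> 0 < e \<and> ?N f B e \<subseteq> \<Union>K"
    proof
      fix f assume "f \<in> \<Union>K"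
      then obtain S where S: "S \<in> K" "f \<in> S" by blast
      then obtain B e where "bounded_lcs B" "0 < e" "?N f B e \<subseteq> S"
        using K by blast
      then show "\<exists>B e. bounded_lcs B \<and> 0 < e \<and> ?N f B e \<subseteq> \<Union>K"
        using S(1) by blast
    qed
  qed
  then show ?thesis
    unfolding strong_dual_topology_def by simp
qed

lemma topspace_strong_dual_topology: "topspace strong_dual_topology = continuous_dual"
proof
  show "topspace strong_dual_topology \<subseteq> continuous_dual"
    unfolding topspace_def by (auto simp: openin_strong_dual_topology)
  have "openin strong_dual_topology continuous_dual"
    unfolding openin_strong_dual_topology
    by (auto intro!: exI[of _ "{}"] exI[of _ 1] bounded_lcs_empty)
  then show "continuous_dual \<subseteq> topspace strong_dual_topology"
    by (rule openin_subset)
qed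


section \<open>Gelfand triples\<close>

locale gelfand_triple =
  fixes pairing :: "'f::complex_lcs \<Rightarrow> 'd::complex_lcs \<Rightarrow> complex"
    and \<ii> :: "'f \<Rightarrow> 'h::complex_hilbert_space"
    and \<jj> :: "'h \<Rightarrow> 'd"
  assumes pairing_add_left: "pairing (g + g') \<mu> = pairing g \<mu> + pairing g' \<mu>"
    and pairing_scaleC_left: "pairing (c *\<^sub>C g) \<mu> = c * pairing g \<mu>"
    and pairing_add_right: "pairing g (\<mu> + \<nu>) = pairing g \<mu> + pairing g \<nu>"
    and pairing_scaleC_right: "pairing g (c *\<^sub>C \<mu>) = cnj c * pairing g \<mu>"
    and pairing_continuous_left: "continuous_on UNIV (\<lambda>g. pairing g \<mu>)"
    and pairing_continuous_right: "continuous_on UNIV (\<lambda>\<mu>. pairing g \<mu>)"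
    and \<ii>_linear: "Vector_Spaces.linear scaleC scaleC \<ii>"
    and \<ii>_continuous: "continuous_on UNIV \<ii>"
    and \<ii>_inj: "inj \<ii>"
    and \<jj>_linear: "Vector_Spaces.linear scaleC scaleC \<jj>"
    and \<jj>_continuous: "continuous_on UNIV \<jj>"
    and \<jj>_inj: "inj \<jj>"
    and \<ii>_dense: "closure (range \<ii>) = UNIV"
    and \<ss>_homeomorphic:
      "homeomorphic_map euclidean strong_dual_topology (\<lambda>\<mu> g. pairing g \<mu>)"
    and pairing_\<jj>: "pairing g (\<jj> h) = cinner (\<ii> g) h"

lemma linear_scaleC_iff:
  "Vector_Spaces.linear scaleC scaleC (f :: 'a::complex_vector \<Rightarrow> 'b::complex_vector) \<longleftrightarrow>
   (\<forall>x y. f (x + y) = f x + f y) \<and> (\<forall>c x. f (c *\<^sub>C x) = c *\<^sub>C f x)"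
  unfolding Vector_Spaces.linear_iff
  by (auto simp: complex_vector.vector_space_axioms)

lemma linear_functional_iff:
  "Vector_Spaces.linear scaleC (*) (f :: 'a::complex_vector \<Rightarrow> complex) \<longleftrightarrow>
   (\<forall>x y. f (x + y) = f x + f y) \<and> (\<forall>c x. f (c *\<^sub>C x) = c * f x)"
  unfolding Vector_Spaces.linear_iff
  by (auto simp: complex_vector.vector_space_axioms vector_space_over_itself.vector_space_axioms)

lemma bounded_lcs_image:
  fixes A :: "'f::complex_lcs \<Rightarrow> 'g::complex_lcs"
  assumes A: "Vector_Spaces.linear scaleC scaleC A" "continuous_on UNIV A" and B: "bounded_lcs B"
  shows "bounded_lcs (A ` B)"
  unfolding bounded_lcs_def
proof (intro allI impI)
  fix U :: "'g set" assume U: "open U \<and> 0 \<in> U"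
  have sc: "A (c *\<^sub>C x) = c *\<^sub>C A x" for c x using A(1) by (simp add: linear_scaleC_iff)
  have "A 0 = 0" using sc[of 0 0] by simp
  moreover have "open (A -` U)" using A(2) U by (metis open_vimage)
  ultimately obtain r where r: "r>0" "\<forall>c. r \<le> cmod c \<longrightarrow> B \<subseteq> scaleC c ` (A -` U)"
    using B U unfolding bounded_lcs_def by (metis vimageI2)
  show "\<exists>r>0. \<forall>c. r \<le> cmod c \<longrightarrow> A ` B \<subseteq> scaleC c ` U"
  proof (intro exI[of _ r] conjI allI impI r(1))
    fix c assume "r \<le> cmod c"
    then have "B \<subseteq> scaleC c ` (A -` U)" using r by blast
    then have "A ` B \<subseteq> A ` scaleC c ` (A -` U)" by blast
    also have "\<dots> \<subseteq> scaleC c ` U" by (auto simp: sc)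
    finally show "A ` B \<subseteq> scaleC c ` U" .
  qed
qed

context gelfand_triple begin

lemma pairing_in_continuous_dual: "(\<lambda>g. pairing g \<mu>) \<in> continuous_dual"
  by (simp add: continuous_dual_def linear_functional_iff pairing_add_left pairing_scaleC_left pairing_continuous_left)

lemma pairing_separates: "(\<And>g. pairing g \<mu> = pairing g \<nu>) \<Longrightarrow> \<mu> = \<nu>"
  using \<ss>_homeomorphic unfolding homeomorphic_map_def inj_on_def by auto

lemma conjugate_dual_map_ex1:
  fixes A :: "'f \<Rightarrow> 'f"
  assumes A: "Vector_Spaces.linear scaleC scaleC A" "continuous_on UNIV A"
  shows "\<exists>!S. Vector_Spaces.linear scaleC scaleC S \<and> continuous_on UNIV S \<and>
       (\<forall>g \<mu>. pairing g (S \<mu>) = pairing (A g) \<mu>)"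
proof -
  let ?s = "\<lambda>\<mu> g. pairing g \<mu>"
  obtain t where t: "homeomorphic_maps euclidean strong_dual_topology ?s t"
    using \<ss>_homeomorphic homeomorphic_map_maps by blast
  have st: "?s (t f) = f" if "f \<in> continuous_dual" for f
    using t that by (simp add: homeomorphic_maps_def topspace_strong_dual_topology)
  have comp: "f \<circ> A \<in> continuous_dual" if "f \<in> continuous_dual" for f
    using that A unfolding continuous_dual_def
    by (auto simp: linear_scaleC_iff linear_functional_iff intro: continuous_on_compose2[of UNIV f])
  have cA: "continuous_map strong_dual_topology strong_dual_topology (\<lambda>f. f \<circ> A)"
    unfolding continuous_map
  proof (intro conjI allI impI)
    show "(\<lambda>f. f \<circ> A) ` topspace strong_dual_topology \<subseteq> topspace strong_dual_topology"
      using comp by (auto simp: topspace_strong_dual_topology)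
    fix U assume U: "openin strong_dual_topology (U :: ('f \<Rightarrow> complex) set)"
    show "openin strong_dual_topology {x \<in> topspace strong_dual_topology. x \<circ> A \<in> U}"
      unfolding openin_strong_dual_topology topspace_strong_dual_topology
    proof (intro conjI ballI)
      fix f assume f: "f \<in> {x \<in> continuous_dual. x \<circ> A \<in> U}"
      then obtain B e where B: "bounded_lcs B" "0 < e"
        "{k \<in> continuous_dual. \<forall>x\<in>B. cmod (k x - (f \<circ> A) x) < e} \<subseteq> U"
        using U unfolding openin_strong_dual_topology by blast
      show "\<exists>B e. bounded_lcs B \<and> 0 < e \<and> {k \<in> continuous_dual. \<forall>x\<in>B. cmod (k x - f x) < e}
          \<subseteq> {x \<in> continuous_dual. x \<circ> A \<in> U}"
        using B comp bounded_lcs_image[OF A B(1)]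
        by (intro exI[of _ "A ` B"] exI[of _ e]) auto
    qed auto
  qed
  define S where "S \<mu> = t (?s \<mu> \<circ> A)" for \<mu>
  have P: "pairing g (S \<mu>) = pairing (A g) \<mu>" for g \<mu>
    using st[OF comp[OF pairing_in_continuous_dual]] unfolding S_def by (metis comp_apply)
  have "continuous_map euclidean euclidean (t \<circ> ((\<lambda>f. f \<circ> A) \<circ> ?s))"
    using t cA unfolding homeomorphic_maps_def by (blast intro: continuous_map_compose)
  then have "continuous_on UNIV S" unfolding S_def by (simp add: o_def)
  moreover have "Vector_Spaces.linear scaleC scaleC S"
    unfolding linear_scaleC_iff
    by (intro conjI allI; rule pairing_separates) (simp_all add: P pairing_add_right pairing_scaleC_right)
  ultimately show ?thesis
    using P by (intro ex1I[of _ S]) (auto intro!: ext pairing_separates)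
qed

end


section \<open>Operators and adjoints\<close>

text \<open>An operator is given by its domain \<open>D\<close> and a total function \<open>T\<close>, whose values outside \<open>D\<close>
  are irrelevant.\<close>

definition linear_operator_on ::
    "'h::complex_hilbert_space set \<Rightarrow> ('h \<Rightarrow> 'h) \<Rightarrow> bool"
  where "linear_operator_on D T \<longleftrightarrow> complex_vector.subspace D \<and>
    (\<forall>x\<in>D. \<forall>y\<in>D. T (x + y) = T x + T y) \<and> (\<forall>c. \<forall>x\<in>D. T (c *\<^sub>C x) = c *\<^sub>C T x)"

definition adjoint_domain ::
    "'h::complex_hilbert_space set \<Rightarrow> ('h \<Rightarrow> 'h) \<Rightarrow> 'h set"
  where "adjoint_domain D T = {y. \<exists>z. \<forall>x\<in>D. cinner (T x) y = cinner x z}"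

definition adjoint_op ::
    "'h::complex_hilbert_space set \<Rightarrow> ('h \<Rightarrow> 'h) \<Rightarrow> 'h \<Rightarrow> 'h"
  where "adjoint_op D T y = (THE z. \<forall>x\<in>D. cinner (T x) y = cinner x z)"

lemma adjoint_op_unique:
  fixes T :: "'h::complex_hilbert_space \<Rightarrow> 'h"
  assumes "closure D = UNIV" "y \<in> adjoint_domain D T"
  shows "\<exists>!z. \<forall>x\<in>D. cinner (T x) y = cinner x z"
proof -
  obtain z where z: "\<forall>x\<in>D. cinner (T x) y = cinner x z"
    using assms(2) unfolding adjoint_domain_def by blast
  then show ?thesis
    by (intro ex1I[of _ z]) (auto intro!: cinner_dense_eq[OF assms(1)])
qed

definition adjoint_restriction ::
    "('f::complex_lcs \<Rightarrow> 'h::complex_hilbert_space) \<Rightarrow> 'h set \<Rightarrow> ('h \<Rightarrow> 'h) \<Rightarrow> 'f \<Rightarrow> 'f"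
  where "adjoint_restriction \<ii> D T = inv \<ii> \<circ> adjoint_op D T \<circ> \<ii>"

text \<open>For linear continuous \<open>adjoint_restriction \<ii> D T\<close> the description is proper, by
  \<open>gelfand_triple.conjugate_dual_map_ex1\<close>.\<close>

definition times_op ::
    "('f::complex_lcs \<Rightarrow> 'd::complex_lcs \<Rightarrow> complex) \<Rightarrow>
     ('f \<Rightarrow> 'h::complex_hilbert_space) \<Rightarrow> 'h set \<Rightarrow> ('h \<Rightarrow> 'h) \<Rightarrow> 'd \<Rightarrow> 'd"
  where "times_op pairing \<ii> D T =
    (THE S. Vector_Spaces.linear scaleC scaleC S \<and> continuous_on UNIV S \<and>
       (\<forall>g \<mu>. pairing g (S \<mu>) = pairing (adjoint_restriction \<ii> D T g) \<mu>))"

end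

theory Submission
  imports Defs
begin

text \<open>Elements of the space \<Phi>* are separated by pairing with \<Phi>, so it suffices to
  test both sides against each g. With A the restricted adjoint, \<open>pairing_\<jj>\<close> turns
  the pairing with \<open>\<jj> (T h)\<close> into an inner product in H, the adjoint moves T onto
  \<open>\<ii> g\<close> as \<open>\<ii> (A g)\<close>, and \<open>pairing_\<jj>\<close> leads back
  to the pairing of A g with \<open>\<jj> h\<close>, which \<open>times_op\<close> represents. The
  supporting lemmas release these identities from the definite descriptions.\<close>

lemma cinner_adjoint_op:
  assumes "closure D = UNIV" "y \<in> adjoint_domain D T" "x \<in> D"
  shows "cinner (T x) y = cinner x (adjoint_op D T y)"
  using theI'[OF adjoint_op_unique[OF assms(1,2)]] assms(3) unfolding adjoint_op_def by blast

text \<open>Invariance of \<open>range \<ii>\<close> makes \<open>inv \<ii>\<close> return a true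
  preimage, so \<open>\<ii>\<close> cancels it.\<close>

lemma cinner_adjoint_restriction:
  assumes "closure D = UNIV" "range \<ii> \<subseteq> adjoint_domain D T"
    and "adjoint_op D T ` range \<ii> \<subseteq> range \<ii>" "x \<in> D"
  shows "cinner (T x) (\<ii> g) = cinner x (\<ii> (adjoint_restriction \<ii> D T g))"
proof -
  have "\<ii> (adjoint_restriction \<ii> D T g) = adjoint_op D T (\<ii> g)"
    using assms(3) by (auto simp: adjoint_restriction_def intro!: f_inv_into_f)
  then show ?thesis
    using cinner_adjoint_op[of D "\<ii> g" T x] assms by auto
qed

context gelfand_triple
begin

text \<open>Linearity is required for \<open>times_op\<close> to be well described. Injectivity of
  \<open>\<ii>\<close> moves each identity into H, where density of D allows testing it by inner
  products.\<close>

lemma linear_adjoint_restriction: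
  assumes D: "closure D = UNIV" "range \<ii> \<subseteq> adjoint_domain D T"
    "adjoint_op D T ` range \<ii> \<subseteq> range \<ii>"
  shows "Vector_Spaces.linear scaleC scaleC (adjoint_restriction \<ii> D T)"
proof -
  note adj = cinner_adjoint_restriction[OF D, symmetric]
  have \<ii>: "\<ii> (x + y) = \<ii> x + \<ii> y" "\<ii> (c *\<^sub>C x) = c *\<^sub>C \<ii> x" for x y c
    using \<ii>_linear by (simp_all add: linear_scaleC_iff)
  show ?thesis
    unfolding linear_scaleC_iff
    \<comment> \<open>Rewriting with \<open>adj\<close> removes the adjoint from the second slot,
      leaving only linearity of \<open>\<ii>\<close> and conjugate-linearity of
      \<open>cinner\<close> there.\<close>
    by (intro conjI allI; rule injD[OF \<ii>_inj]; rule cinner_dense_eq[OF D(1)])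
      (simp_all add: adj \<ii> cinner_add_right cinner_scaleC_right)
qed

lemma pairing_times_op:
  assumes "Vector_Spaces.linear scaleC scaleC (adjoint_restriction \<ii> D T)"
    and "continuous_on UNIV (adjoint_restriction \<ii> D T)"
  shows "pairing g (times_op pairing \<ii> D T \<mu>) = pairing (adjoint_restriction \<ii> D T g) \<mu>"
  using theI'[OF conjugate_dual_map_ex1[OF assms]] unfolding times_op_def by blast

end

theorem proposition4p3:
  fixes pairing :: "'f::complex_lcs \<Rightarrow> 'd::complex_lcs \<Rightarrow> complex"
    and \<ii> :: "'f \<Rightarrow> 'h::complex_hilbert_space"
    and \<jj> :: "'h \<Rightarrow> 'd"
    and D :: "'h set" and T :: "'h \<Rightarrow> 'h" and h :: 'h
  assumes "gelfand_triple pairing \<ii> \<jj>"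
    and "linear_operator_on D T"
    and "closure D = UNIV"
    and "range \<ii> \<subseteq> adjoint_domain D T"
    and "adjoint_op D T ` range \<ii> \<subseteq> range \<ii>"
    and "continuous_on UNIV (adjoint_restriction \<ii> D T)"
    and "h \<in> D"
  shows "\<jj> (T h) = times_op pairing \<ii> D T (\<jj> h)"
proof -
  interpret gelfand_triple pairing \<ii> \<jj> by fact
  show ?thesis
  proof (rule pairing_separates)
    fix g
    let ?A = "adjoint_restriction \<ii> D T"
    \<comment> \<open>The conjugate swaps the slots: the adjoint relation has T in the first one,
      \<open>pairing_\<jj>\<close> has h in the second.\<close>
    have "pairing g (\<jj> (T h)) = cnj (cinner (T h) (\<ii> g))"
      by (simp add: pairing_\<jj> flip: cinner_commute)
    also have "\<dots> = cnj (cinner h (\<ii> (?A g)))"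
      using cinner_adjoint_restriction[OF assms(3-5,7)] by simp
    also have "\<dots> = pairing (?A g) (\<jj> h)"
      by (simp add: pairing_\<jj> flip: cinner_commute)
    also have "\<dots> = pairing g (times_op pairing \<ii> D T (\<jj> h))"
      using pairing_times_op[OF linear_adjoint_restriction[OF assms(3-5)] assms(6)] by simp
    finally show "pairing g (\<jj> (T h)) = pairing g (times_op pairing \<ii> D T (\<jj> h))" .
  qed
qed

end
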